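(* For any constant $\epsilon>0$, there exists a deterministic $(\epsilon n)$-approximation algorithm for XOS maximization in the value oracle model that runs in $O(n^{\lceil 1/\epsilon\rceil})$ time. That is, for every XOS function $f\colon 2^V\to\mathbb{R}$ on a finite nonempty ground set $V$ of size $n$ (with $\epsilon n\ge 1$) given by a value oracle, the algorithm always returns a set $\tilde X\subseteq V$ with $f(\tilde X)\ge \frac{1}{\epsilon n}\max_{X\subseteq V}f(X)$.
   Context: A set function $f\colon 2^V\to\mathbb{R}$ is additive if $f(X)=\sum_{v\in X}f(\{v\})$ for all $X\subseteq V$. It is XOS if there are finitely many additive functions $f_1,\dots,f_k\colon 2^V\to\mathbb{R}$ (values may be negative) such that $f(X)=\max_{i\in[k]}f_i(X)$ for all $X\subseteq V$, where $[k]=\{1,\dots,k\}$; $f$ need not be monotone. XOS maximization: given an XOS function $f$ on $V$, $n=|V|$, accessible only through a value oracle (a query $X\subseteq V$ returns $f(X)$; the additive functions are not given), find $X\subseteq V$ maximizing $f(X)$. For $\alpha\ge 1$, $\tilde X\subseteq V$ is an $\alpha$-maximizer if $f(\tilde X)\ge\frac1\alpha\max_{X\subseteq V}f(X)$; a deterministic algorithm is an $\alpha$-approximation algorithm if it always returns an $\alpha$-maximizer. Running time is measured by the number of value oracle calls, which asymptotically dominates the remaining computation. *)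

theory Defs
  imports Complex_Main "HOL-Library.Landau_Symbols"
begin

text \<open>
  Set functions on a ground set \<open>V\<close> are functions on the whole type of sets; only
  their values on subsets of \<open>V\<close> matter.
\<close>

definition additive_on :: "'a set \<Rightarrow> ('a set \<Rightarrow> real) \<Rightarrow> bool" where
  "additive_on V f \<longleftrightarrow> (\<forall>X\<subseteq>V. f X = (\<Sum>v\<in>X. f {v}))"

definition xos_on :: "'a set \<Rightarrow> ('a set \<Rightarrow> real) \<Rightarrow> bool" where
  "xos_on V f \<longleftrightarrow>
     (\<exists>(k::nat) (g :: nat \<Rightarrow> 'a set \<Rightarrow> real).
        k \<ge> 1 \<and> (\<forall>i\<in>{1..k}. additive_on V (g i)) \<and>
        (\<forall>X\<subseteq>V. f X = Max ((\<lambda>i. g i X) ` {1..k})))"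

definition maximizer_on :: "real \<Rightarrow> 'a set \<Rightarrow> ('a set \<Rightarrow> real) \<Rightarrow> 'a set \<Rightarrow> bool" where
  "maximizer_on \<alpha> V f X \<longleftrightarrow> X \<subseteq> V \<and> f X \<ge> 1 / \<alpha> * Max (f ` Pow V)"

text \<open>
  A deterministic computation with a value oracle is an adaptive decision tree: it either
  stops with an output set, or queries a set and continues depending on the real number
  returned. Every branch of an inductive datatype is finite, so computations terminate
  on every oracle.
\<close>

datatype 'a oracle_comp =
    Return "'a set"
  | Query "'a set" "real \<Rightarrow> 'a oracle_comp"

primrec result_of :: "('a set \<Rightarrow> real) \<Rightarrow> 'a oracle_comp \<Rightarrow> 'a set" where
  "result_of f (Return X) = X"
| "result_of f (Query Q c) = result_of f (c (f Q))"

primrec queries :: "('a set \<Rightarrow> real) \<Rightarrow> 'a oracle_comp \<Rightarrow> 'a set list" where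
  "queries f (Return X) = []"
| "queries f (Query Q c) = Q # queries f (c (f Q))"

text \<open>
  An algorithm receives the ground set as a list of its elements without repetitions, and
  accesses the set function only through the oracle.
\<close>

type_synonym 'a oracle_alg = "'a list \<Rightarrow> 'a oracle_comp"

text \<open>
  The approximation factor is a function \<open>\<alpha>\<close> of \<open>n = length vs\<close>, the size of the ground
  set; the guarantee is required whenever \<open>\<alpha> n \<ge> 1\<close>.
\<close>

definition xos_approx_alg :: "(nat \<Rightarrow> real) \<Rightarrow> 'a oracle_alg \<Rightarrow> bool" where
  "xos_approx_alg \<alpha> A \<longleftrightarrow>
     (\<forall>vs f. distinct vs \<longrightarrow> vs \<noteq> [] \<longrightarrow> \<alpha> (length vs) \<ge> 1 \<longrightarrow> xos_on (set vs) f \<longrightarrow>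
        maximizer_on (\<alpha> (length vs)) (set vs) f (result_of f (A vs)))"

text \<open>
  Running time is the number of oracle calls, repeated queries included. Only subsets of
  the ground set may be queried. The bound \<open>T\<close> is worst case over all XOS functions.
\<close>

definition xos_time_bound :: "(nat \<Rightarrow> nat) \<Rightarrow> 'a oracle_alg \<Rightarrow> bool" where
  "xos_time_bound T A \<longleftrightarrow>
     (\<forall>vs f. distinct vs \<longrightarrow> vs \<noteq> [] \<longrightarrow> xos_on (set vs) f \<longrightarrow>
        set (queries f (A vs)) \<subseteq> Pow (set vs) \<and>
        length (queries f (A vs)) \<le> T (length vs))"

end

(* Let g be an additive function of the family attaining the maximum of f at X, and let
   k = ceiling (1 / epsilon). Discarding elements of least weight from X never decreases the
   average weight, so if X has at least k elements, some k-element subset S of X satisfies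
   f S \<ge> g S \<ge> (k / card X) * f X \<ge> f X / (epsilon * n). Hence it suffices to query all nonempty
   sets of at most k elements, and these are the sets of entries of the n^k lists of length k.
   Averaging avoids the loss of rounding up n / k that subadditivity alone would cause. *)
theory Submission
  imports Defs
begin

text \<open>Induction on \<open>card X\<close>, removing an element of at most average weight until
  \<open>k\<close> remain. The comparison of averages is cleared of denominators, so
  \<open>k = 0\<close> and empty \<open>X\<close> need no exception; weights may be
  negative.\<close>

lemma sum_le_card_mult_sum_subset:
  fixes w :: "'a \<Rightarrow> real"
  assumes "finite X" "k \<le> card X"
  shows "\<exists>S\<subseteq>X. card S = k \<and> real k * sum w X \<le> real (card X) * sum w S"
  using assms
proof (induction "card X" arbitrary: X)
  case 0
  then show ?case by auto
next
  case (Suc m)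
  show ?case
  proof (cases "k = Suc m \<or> k = 0")
    case True
    then show ?thesis using Suc.hyps(2) by (cases "k = 0") auto
  next
    case False
    then have k: "0 < k" "k \<le> m" using Suc.prems(2) Suc.hyps(2) by auto
    \<comment> \<open>If every weight exceeded the average, summing over \<open>X\<close> would make
      \<open>Suc m * sum w X\<close> less than itself.\<close>
    have "\<exists>x\<in>X. real (Suc m) * w x \<le> sum w X"
    proof (rule ccontr)
      assume "\<not> (\<exists>x\<in>X. real (Suc m) * w x \<le> sum w X)"
      moreover have "X \<noteq> {}" using Suc.hyps(2) by auto
      ultimately have "(\<Sum>x\<in>X. sum w X) < (\<Sum>x\<in>X. real (Suc m) * w x)"
        using Suc.prems(1) by (intro sum_strict_mono) (auto simp: not_le)
      then show False
        using Suc.hyps(2) by (simp flip: sum_distrib_left)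
    qed
    then obtain x where x: "x \<in> X" "real (Suc m) * w x \<le> sum w X" by blast
    have m: "m = card (X - {x})" using x(1) Suc.hyps(2) Suc.prems(1) by simp
    obtain S where S: "S \<subseteq> X - {x}" "card S = k" "real k * sum w (X - {x}) \<le> real m * sum w S"
      using Suc.hyps(1)[OF m] Suc.prems(1) k(2) m by auto
    have rem: "sum w (X - {x}) = sum w X - w x"
      using x(1) Suc.prems(1) by (simp add: sum_diff1)
    have "real m * sum w X \<le> real (Suc m) * sum w (X - {x})"
      using x(2) unfolding rem by (simp add: algebra_simps)
    \<comment> \<open>Scaling this bound by \<open>k\<close> and the induction hypothesis by
      \<open>Suc m\<close> gives both the same middle term. The common factor \<open>m\<close> then
      cancels, being positive by \<open>0 < k\<close> and \<open>k \<le> m\<close>.\<close>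
    then have "real k * (real m * sum w X) \<le> real k * (real (Suc m) * sum w (X - {x}))"
      by (intro mult_left_mono) auto
    also have "\<dots> = real (Suc m) * (real k * sum w (X - {x}))" by simp
    also have "\<dots> \<le> real (Suc m) * (real m * sum w S)"
      using S(3) by (intro mult_left_mono) auto
    finally have "real m * (real k * sum w X) \<le> real m * (real (Suc m) * sum w S)"
      by (simp add: mult.left_commute)
    then have "real k * sum w X \<le> real (Suc m) * sum w S"
      using k by (subst (asm) mult_le_cancel_left_pos) auto
    then show ?thesis using S Suc.hyps(2) by auto
  qed
qed

lemma xos_on_empty:
  assumes "xos_on V f"
  shows "f {} = 0"
proof -
  obtain k :: nat and g where k: "k \<ge> 1" "\<forall>i\<in>{1..k}. additive_on V (g i)"
      "\<forall>X\<subseteq>V. f X = Max ((\<lambda>i. g i X) ` {1..k})"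
    using assms unfolding xos_on_def by blast
  have "(\<lambda>i. g i {}) ` {1..k} = {0}"
    using k(1,2) by (auto simp: additive_on_def image_iff)
  then show ?thesis using k(3) by simp
qed

text \<open>The singleton values of an additive function attaining the maximum at \<open>X\<close>
  serve as \<open>w\<close>: exact at \<open>X\<close>, and below the maximum everywhere
  else.\<close>

lemma xos_on_support:
  assumes "xos_on V f" "X \<subseteq> V"
  obtains w :: "'a \<Rightarrow> real" where "f X = sum w X" "\<And>S. S \<subseteq> V \<Longrightarrow> sum w S \<le> f S"
proof -
  obtain k :: nat and g where k: "k \<ge> 1" "\<forall>i\<in>{1..k}. additive_on V (g i)"
      "\<forall>X\<subseteq>V. f X = Max ((\<lambda>i. g i X) ` {1..k})"
    using assms unfolding xos_on_def by blast
  have "f X \<in> (\<lambda>i. g i X) ` {1..k}"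
    using k(1,3) assms(2) Max_in[of "(\<lambda>i. g i X) ` {1..k}"] by simp
  then obtain i where i: "i \<in> {1..k}" "f X = g i X" by blast
  have sum: "g i S = (\<Sum>v\<in>S. g i {v})" if "S \<subseteq> V" for S
    using k(2) i(1) that by (simp add: additive_on_def)
  have "(\<Sum>v\<in>S. g i {v}) \<le> f S" if "S \<subseteq> V" for S
    using Max_ge[OF _ imageI[OF i(1)], of "\<lambda>i. g i S"] k(3) that sum[OF that] by simp
  then show ?thesis using that[of "\<lambda>v. g i {v}"] i(2) sum[OF assms(2)] by simp
qed

lemma xos_on_subset_of_card:
  assumes "xos_on V f" "finite V" "X \<subseteq> V" "k \<le> card X"
  obtains S where "S \<subseteq> X" "card S = k" "real k * f X \<le> real (card X) * f S"
proof -
  obtain w where w: "f X = sum w X" "\<And>S. S \<subseteq> V \<Longrightarrow> sum w S \<le> f S"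
    using xos_on_support[OF assms(1,3)] by blast
  obtain S where S: "S \<subseteq> X" "card S = k" "real k * sum w X \<le> real (card X) * sum w S"
    using sum_le_card_mult_sum_subset[of X k w] assms finite_subset by blast
  have "real (card X) * sum w S \<le> real (card X) * f S"
    using w(2)[of S] S(1) assms(3) by (intro mult_left_mono) auto
  then show ?thesis using that S w(1) by auto
qed

lemma set_in_n_lists:
  assumes "finite S" "S \<noteq> {}" "S \<subseteq> set vs" "card S \<le> k"
  shows "S \<in> set ` set (List.n_lists k vs)"
proof -
  obtain xs where xs: "set xs = S" "distinct xs" using assms(1) finite_distinct_list by blast
  \<comment> \<open>Repeating an entry pads the list to length exactly \<open>k\<close> without
    changing its set; an entry exists because \<open>S\<close> is nonempty.\<close>
  define ys where "ys = xs @ replicate (k - length xs) (hd xs)"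
  have "xs \<noteq> []" using assms(2) xs(1) by auto
  then have "set ys = S" using xs by (auto simp: ys_def)
  moreover have "length ys = k"
    using assms(4) distinct_card[OF xs(2)] xs(1) by (simp add: ys_def)
  ultimately show ?thesis using assms(3) by (auto simp: set_n_lists)
qed

text \<open>\<open>B\<close> is the best set so far and \<open>b\<close> its known value, carried
  along so that \<open>B\<close> is never queried again.\<close>

primrec argmax_search :: "'a set list \<Rightarrow> 'a set \<Rightarrow> real \<Rightarrow> 'a oracle_comp" where
  "argmax_search [] B b = Return B"
| "argmax_search (Q # Qs) B b =
     Query Q (\<lambda>y. if b < y then argmax_search Qs Q y else argmax_search Qs B b)"

text \<open>The answers only affect which set is remembered, so the search is nonadaptive and its
  cost is the length of \<open>Qs\<close>.\<close>

lemma queries_argmax_search: "queries f (argmax_search Qs B b) = Qs"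
  by (induction Qs arbitrary: B b) auto

lemma result_argmax_search_in: "result_of f (argmax_search Qs B b) \<in> insert B (set Qs)"
proof (induction Qs arbitrary: B b)
  case (Cons Q Qs)
  show ?case using Cons[of Q "f Q"] Cons[of B b] by auto
qed simp

lemma result_argmax_search_ge:
  assumes "f B = b" "X \<in> insert B (set Qs)"
  shows "f X \<le> f (result_of f (argmax_search Qs B b))"
  using assms
proof (induction Qs arbitrary: B b X)
  case (Cons Q Qs)
  show ?case
  proof (cases "b < f Q")
    case True
    \<comment> \<open>The instance at \<open>Q\<close> covers \<open>X = B\<close>, which
      \<open>Q\<close> has just beaten; the instance at \<open>X\<close> covers the other
      cases.\<close>
    then show ?thesis
      using Cons.IH[of Q "f Q" Q] Cons.IH[of Q "f Q" X] Cons.prems by force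
  next
    case False
    then show ?thesis
      using Cons.IH[of B b B] Cons.IH[of B b X] Cons.prems by force
  qed
qed simp

text \<open>The empty set need not be queried, because every XOS function vanishes there.\<close>

definition small_sets_alg :: "nat \<Rightarrow> 'a oracle_alg" where
  "small_sets_alg k vs = argmax_search (map set (List.n_lists k vs)) {} 0"

lemma xos_time_bound_small_sets_alg: "xos_time_bound (\<lambda>n. n ^ k) (small_sets_alg k)"
  unfolding xos_time_bound_def small_sets_alg_def
  by (auto simp: queries_argmax_search length_n_lists set_n_lists)

lemma small_sets_alg_subset: "result_of f (small_sets_alg k vs) \<subseteq> set vs"
  using result_argmax_search_in[of f "map set (List.n_lists k vs)" "{}" 0]
  by (auto simp: small_sets_alg_def set_n_lists)

lemma small_sets_alg_ge:
  assumes "xos_on (set vs) f" "S \<subseteq> set vs" "card S \<le> k"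
  shows "f S \<le> f (result_of f (small_sets_alg k vs))"
  unfolding small_sets_alg_def
proof (rule result_argmax_search_ge)
  show "f {} = 0" using xos_on_empty[OF assms(1)] .
  show "S \<in> insert {} (set (map set (List.n_lists k vs)))"
    using set_in_n_lists[of S vs k] assms(2,3) finite_subset[OF assms(2)] by auto
qed

lemma xos_approx_alg_small_sets_alg:
  assumes "\<epsilon> > 0" "real k \<ge> 1 / \<epsilon>"
  shows "xos_approx_alg (\<lambda>n. \<epsilon> * real n) (small_sets_alg k)"
  unfolding xos_approx_alg_def
proof (intro allI impI)
  fix vs :: "'a list" and f
  assume vs: "distinct vs" "vs \<noteq> []" and ge: "\<epsilon> * real (length vs) \<ge> 1"
    and xos: "xos_on (set vs) f"
  define R where "R = result_of f (small_sets_alg k vs)"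
  define n where "n = length vs"
  have R: "f S \<le> f R" if "S \<subseteq> set vs" "card S \<le> k" for S
    using small_sets_alg_ge[OF xos that] by (simp add: R_def)
  \<comment> \<open>The sign lets the factor in front of \<open>f R\<close> grow: from 1 to
    \<open>\<epsilon> * n\<close> for small \<open>X\<close>, and from \<open>card X\<close> to
    \<open>n\<close> for large \<open>X\<close>.\<close>
  have R_nonneg: "0 \<le> f R" using R[of "{}"] xos_on_empty[OF xos] by simp
  have "f X \<le> \<epsilon> * real n * f R" if X: "X \<subseteq> set vs" for X
  proof (cases "card X \<le> k")
    case True
    have "1 * f R \<le> \<epsilon> * real n * f R"
      using ge R_nonneg by (intro mult_right_mono) (auto simp: n_def)
    then show ?thesis using R[OF X True] by simp
  next
    case False
    then obtain S where S: "S \<subseteq> X" "card S = k" "real k * f X \<le> real (card X) * f S"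
      using xos_on_subset_of_card[OF xos _ X, of k] by auto
    have "card X \<le> n"
      using card_mono[OF _ X] vs(1) by (simp add: n_def distinct_card)
    have "real k * f X \<le> real (card X) * f R"
      using S(3) mult_left_mono[OF R[of S], of "real (card X)"] S X by force
    also have "\<dots> \<le> real n * f R"
      using \<open>card X \<le> n\<close> R_nonneg by (intro mult_right_mono) auto
    finally have le: "real k * f X \<le> real n * f R" .
    show ?thesis
    \<comment> \<open>Replacing \<open>k\<close> by the smaller \<open>1 / \<epsilon>\<close> is
      sound only for nonnegative \<open>f X\<close>, and \<open>f\<close> may take negative
      values.\<close>
    proof (cases "f X \<le> 0")
      case True
      have "0 \<le> \<epsilon> * real n * f R" using assms(1) R_nonneg by simp
      then show ?thesis using True by simp
    next
      case False
      then have "1 / \<epsilon> * f X \<le> real k * f X" using assms(2) by (intro mult_right_mono) auto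
      then have "1 / \<epsilon> * f X \<le> real n * f R" using le by simp
      then show ?thesis using assms(1) by (simp add: field_simps)
    qed
  qed
  then have "Max (f ` Pow (set vs)) \<le> \<epsilon> * real n * f R"
    by (subst Max_le_iff) auto
  then have "1 / (\<epsilon> * real n) * Max (f ` Pow (set vs)) \<le> f R"
    using assms(1) vs(2) by (simp add: n_def field_simps)
  then show "maximizer_on (\<epsilon> * real (length vs)) (set vs) f (result_of f (small_sets_alg k vs))"
    using small_sets_alg_subset[of f k vs] by (simp add: maximizer_on_def R_def n_def)
qed

theorem theorem1:
  fixes \<epsilon> :: real
  assumes "\<epsilon> > 0"
  shows "\<exists>(A :: 'a oracle_alg) (T :: nat \<Rightarrow> nat).
           xos_approx_alg (\<lambda>n. \<epsilon> * real n) A \<and>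
           xos_time_bound T A \<and>
           (\<lambda>n. real (T n)) \<in> O(\<lambda>n. real n ^ nat \<lceil>1 / \<epsilon>\<rceil>)"
proof (intro exI conjI)
  let ?k = "nat \<lceil>1 / \<epsilon>\<rceil>"
  show "xos_approx_alg (\<lambda>n. \<epsilon> * real n) (small_sets_alg ?k :: 'a oracle_alg)"
    using assms by (intro xos_approx_alg_small_sets_alg real_nat_ceiling_ge)
  show "xos_time_bound (\<lambda>n. n ^ ?k) (small_sets_alg ?k :: 'a oracle_alg)"
    by (rule xos_time_bound_small_sets_alg)
  show "(\<lambda>n. real (n ^ ?k)) \<in> O(\<lambda>n. real n ^ ?k)"
    by simp
qed

end
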